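(* Let $\sigma$ be a switch table for a subgroup $G$ of $\mathrm{Sym}(n)$. Let $1\le i\le n$ and let $G_{i-1}$ be the point-wise stabilizer of $[i-1]$ in $G$. Let $S$ and $S'$ be subsets of $[n]\setminus[i-1]$ with identical cardinality. Then: (i) If $S=\emptyset$ or $S=[n]\setminus[i-1]$, then there is no permutation $g\in G_{i-1}$ with $g(S')\prec S$. (ii) If $G$ is the trivial group or $i>\max R$, where $R$ is the effective row set of $\sigma$, then there is a permutation $g\in G_{i-1}$ with $g(S')\prec S$ if and only if $S'\prec S$. (iii) If $i\in S$: if (a) $i\in S'$ and there is a permutation $g'\in G_i$ with $g'(S'\setminus\{i\})\prec S\setminus\{i\}$, or (b) there is a non-trivial switch $\sigma_{i,j}$ with $j\in S'$ and a permutation $g'\in G_i$ with $g'\bigl(\sigma_{i,j}(S'\setminus\{j\})\bigr)\prec S\setminus\{i\}$, then there is a permutation $g\in G_{i-1}$ with $g(S')\prec S$. If neither (a) nor (b) occurs, then there is no permutation $g\in G_{i-1}$ with $g(S')\prec S$. (iv) If $i\notin S$: if (a) $i\in S'$, or (b) $C(i)\cap S'\neq\emptyset$, where $C(i)$ is the effective column set of row $i$, or (c) there is a permutation $g'\in G_i$ with $g'(S')\prec S$, or (d) there is a switch $\sigma_{i,j}$ with $j\notin S'$ and a permutation $g'\in G_i$ with $g'\bigl(\sigma_{i,j}(S')\bigr)\prec S$, then there is a permutation $g\in G_{i-1}$ with $g(S')\prec S$. If none of these four cases occurs, then there is no permutation $g\in G_{i-1}$ with $g(S')\prec S$. In particular,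 for $i=1$ and $S'=S$ these conditions characterize whether there is a permutation $g\in G$ with $g(S)\prec S$.
   Context: $[n]=\{1,\dots,n\}$, $[0]=\emptyset$. Permutations act on subsets elementwise. Lexicographic order on subsets: $\emptyset\prec S$ for $S\neq\emptyset$, and for non-empty $S,R$: $S\prec R$ iff $\min S<\min R$, or $\min S=\min R$ and $S\setminus\{\min S\}\prec R\setminus\{\min R\}$. $G_i$ denotes the point-wise stabilizer $\{g\in G: g(k)=k\text{ for all }k\le i\}$, so $G_0=G$. A switch table for $G$ is a function $\sigma:[n]\times[n]\to G$, $(i,j)\mapsto\sigma_{i,j}$, such that for $j>i$, if some $g\in G$ satisfies $g(j)=i$ and $g(k)=k$ for all $k<i$, then $\sigma_{i,j}$ is one such $g$; in all other cases $\sigma_{i,j}=\mathrm{id}$. The entries are called switches; an entry is trivial if it is the identity. A row $i$ is effective if it contains at least one non-trivial switch; the effective row set $R$ is the set of indices of effective rows, with $\max R=-\infty$ if $R=\emptyset$. The effective column set $C(i)$ of row $i$ is the set of column indices $j$ of non-trivial switches $\sigma_{i,j}$ (empty if row $i$ is not effective). *)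

theory Defs
  imports "HOL-Algebra.Sym_Groups" "HOL-Library.Extended"
begin

(* Lexicographic order on finite sets of natural numbers.  The finiteness guard is only there
   because Min is unspecified on infinite sets; no pair involving an infinite set is related. *)
function set_prec :: "nat set \<Rightarrow> nat set \<Rightarrow> bool" (infix "\<prec>\<^sub>l\<^sub>e\<^sub>x" 50) where
  "S \<prec>\<^sub>l\<^sub>e\<^sub>x R \<longleftrightarrow>
     (if infinite S \<or> infinite R then False
      else if S = {} then R \<noteq> {}
      else if R = {} then False
      else if Min S = Min R then S - {Min S} \<prec>\<^sub>l\<^sub>e\<^sub>x R - {Min R}
      else Min S < Min R)"
  by auto
termination
  by (relation "measure (\<lambda>(S, R). card S)") (auto intro!: card_Diff1_less, metis Min_in empty_iff)

declare set_prec.simps [simp del]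

definition pointwise_stabilizer :: "(nat \<Rightarrow> nat) set \<Rightarrow> nat \<Rightarrow> (nat \<Rightarrow> nat) set" where
  "pointwise_stabilizer G i = {g \<in> G. \<forall>k\<in>{1..i}. g k = k}"

definition switch_candidates :: "(nat \<Rightarrow> nat) set \<Rightarrow> nat \<Rightarrow> nat \<Rightarrow> (nat \<Rightarrow> nat) set" where
  "switch_candidates G i j = {g \<in> G. g j = i \<and> (\<forall>k\<in>{1..<i}. g k = k)}"

(* Only the values of \<sigma> at i, j in {1..n} matter. *)
definition switch_table ::
  "nat \<Rightarrow> (nat \<Rightarrow> nat) set \<Rightarrow> (nat \<Rightarrow> nat \<Rightarrow> (nat \<Rightarrow> nat)) \<Rightarrow> bool" where
  "switch_table n G \<sigma> \<longleftrightarrow>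
     (\<forall>i\<in>{1..n}. \<forall>j\<in>{1..n}. \<sigma> i j \<in> G \<and>
        (if i < j \<and> switch_candidates G i j \<noteq> {}
         then \<sigma> i j \<in> switch_candidates G i j
         else \<sigma> i j = id))"

definition effective_columns ::
  "nat \<Rightarrow> (nat \<Rightarrow> nat \<Rightarrow> (nat \<Rightarrow> nat)) \<Rightarrow> nat \<Rightarrow> nat set" where
  "effective_columns n \<sigma> i = {j \<in> {1..n}. \<sigma> i j \<noteq> id}"

definition effective_rows :: "nat \<Rightarrow> (nat \<Rightarrow> nat \<Rightarrow> (nat \<Rightarrow> nat)) \<Rightarrow> nat set" where
  "effective_rows n \<sigma> = {i \<in> {1..n}. \<exists>j\<in>{1..n}. \<sigma> i j \<noteq> id}"

(* Maximum with the convention that the maximum of the empty set is minus infinity. *)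
definition Max_ext :: "nat set \<Rightarrow> nat extended" where
  "Max_ext R = (if R = {} then Minf else Fin (Max R))"

end

theory Submission
  imports Defs
begin

text \<open>
  An element \<open>g\<close> of \<open>G\<^bsub>i-1\<^esub>\<close> is classified by the preimage \<open>j\<close> of \<open>i\<close>: either \<open>j = i\<close> and \<open>g\<close> already
  lies in \<open>G\<^bsub>i\<^esub>\<close>, or \<open>j > i\<close> and \<open>g\<close> is a switch \<open>\<sigma>\<^bsub>i,j\<^esub>\<close> followed by an element of \<open>G\<^bsub>i\<^esub>\<close>, since
  the switches of row \<open>i\<close> represent the cosets of \<open>G\<^bsub>i\<^esub>\<close> in \<open>G\<^bsub>i-1\<^esub>\<close>. All sets in question live in
  \<open>{i..n}\<close>, so a lexicographic comparison is decided by which of the two sets contains \<open>i\<close>; only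
  if both or neither do does the comparison carry over to \<open>G\<^bsub>i\<^esub>\<close>.
\<close>

section \<open>Lexicographic comparison of finite sets with a common lower bound\<close>

lemma set_prec_irrefl: "\<not> A \<prec>\<^sub>l\<^sub>e\<^sub>x A"
proof (induction "card A" arbitrary: A rule: less_induct)
  case less
  show ?case
  proof (cases "infinite A \<or> A = {}")
    case True
    then show ?thesis by (subst set_prec.simps) auto
  next
    case False
    then have "card (A - {Min A}) < card A"
      by (meson Min_in card_Diff1_less)
    from less[OF this] False show ?thesis
      by (subst set_prec.simps) auto
  qed
qed

lemma not_set_prec_empty: "\<not> A \<prec>\<^sub>l\<^sub>e\<^sub>x {}"
  by (subst set_prec.simps) auto

lemma Min_eq_lower_bound:
  fixes i :: nat
  assumes "finite A" "A \<subseteq> {i..}" "i \<in> A"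
  shows "Min A = i"
  using assms by (intro Min_eqI) auto

lemma Min_greater_lower_bound:
  fixes i :: nat
  assumes "finite A" "A \<subseteq> {i..}" "A \<noteq> {}" "i \<notin> A"
  shows "i < Min A"
  using assms by (metis Min_in atLeast_iff nat_less_le subsetD)

lemma set_prec_remove_common_min:
  assumes "finite A" "finite B" "A \<subseteq> {i..}" "B \<subseteq> {i..}" "i \<in> A" "i \<in> B"
  shows "A \<prec>\<^sub>l\<^sub>e\<^sub>x B \<longleftrightarrow> A - {i} \<prec>\<^sub>l\<^sub>e\<^sub>x B - {i}"
  using assms by (subst set_prec.simps) (auto simp: Min_eq_lower_bound)

text \<open>The minimum of \<open>A\<close> is \<open>i\<close>, and every element of
  \<open>B\<close> exceeds it. Nonemptiness of \<open>B\<close> matters, since nothing precedes the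
  empty set.\<close>

lemma set_prec_if_min_left:
  assumes "finite A" "finite B" "A \<subseteq> {i..}" "B \<subseteq> {i..}" "i \<in> A" "i \<notin> B" "B \<noteq> {}"
  shows "A \<prec>\<^sub>l\<^sub>e\<^sub>x B"
proof -
  have "Min A = i" "i < Min B" "A \<noteq> {}"
    using assms by (auto intro: Min_eq_lower_bound Min_greater_lower_bound)
  then show ?thesis
    using assms by (subst set_prec.simps) (simp del: Min_gr_iff)
qed

text \<open>The mirror image of the preceding case. Here \<open>A\<close> must be nonempty, since
  the empty set does precede \<open>B\<close>.\<close>

lemma not_set_prec_if_min_right:
  assumes "finite A" "finite B" "A \<subseteq> {i..}" "B \<subseteq> {i..}" "i \<notin> A" "i \<in> B" "A \<noteq> {}"
  shows "\<not> A \<prec>\<^sub>l\<^sub>e\<^sub>x B"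
proof -
  have "Min B = i" "i < Min A"
    using assms by (auto intro: Min_eq_lower_bound Min_greater_lower_bound)
  then show ?thesis
    using assms by (subst set_prec.simps) (simp del: Min_gr_iff)
qed

lemma effective_row_le_Max_ext:
  assumes "k \<in> effective_rows n \<sigma>"
  shows "Fin k \<le> Max_ext (effective_rows n \<sigma>)"
  using assms by (auto simp: Max_ext_def effective_rows_def)

section \<open>Stabilizers and switches of a permutation group\<close>

locale permutation_group_switch_table =
  fixes n :: nat and G :: "(nat \<Rightarrow> nat) set" and \<sigma> :: "nat \<Rightarrow> nat \<Rightarrow> (nat \<Rightarrow> nat)"
  assumes subgroup: "subgroup G (sym_group n)"
    and switch_table: "switch_table n G \<sigma>"
begin

lemma permutes: "g \<in> G \<Longrightarrow> g permutes {1..n}"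
  using subgroup.subset[OF subgroup] by (auto simp: sym_group_carrier)

lemma id_mem: "id \<in> G"
  using subgroup.one_closed[OF subgroup] by (simp add: sym_group_one)

lemma comp_mem: "g \<in> G \<Longrightarrow> h \<in> G \<Longrightarrow> g \<circ> h \<in> G"
  using subgroup.m_closed[OF subgroup] by (simp add: sym_group_mult)

lemma inv_mem:
  assumes "g \<in> G"
  shows "inv' g \<in> G"
  using subgroup.m_inv_closed[OF subgroup assms] permutes[OF assms]
  by (simp add: sym_group_inv_equality sym_group_carrier)

lemma pointwise_stabilizer_0: "pointwise_stabilizer G 0 = G"
  by (simp add: pointwise_stabilizer_def)

lemma pointwise_stabilizer_subset: "pointwise_stabilizer G k \<subseteq> G"
  by (auto simp: pointwise_stabilizer_def)

lemma id_mem_stabilizer: "id \<in> pointwise_stabilizer G k"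
  by (simp add: pointwise_stabilizer_def id_mem)

lemma comp_mem_stabilizer:
  "g \<in> pointwise_stabilizer G k \<Longrightarrow> h \<in> pointwise_stabilizer G k \<Longrightarrow>
    g \<circ> h \<in> pointwise_stabilizer G k"
  by (auto simp: pointwise_stabilizer_def intro: comp_mem)

lemma bij: "g \<in> G \<Longrightarrow> bij g"
  using permutes permutes_bij by blast

text \<open>A bijection of \<open>{1..n}\<close> that fixes \<open>{1..k}\<close> pointwise must
  permute the remaining points among themselves. This keeps all images above the lower bound needed
  for the comparison lemmas.\<close>

lemma stabilizer_image_tail:
  assumes g: "g \<in> pointwise_stabilizer G k" and "k \<le> n"
  shows "g ` ({1..n} - {1..k}) = {1..n} - {1..k}"
proof -
  have "g \<in> G" and fixed: "\<forall>l\<in>{1..k}. g l = l"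
    using g by (auto simp: pointwise_stabilizer_def)
  have "g ` ({1..n} - {1..k}) = g ` {1..n} - g ` {1..k}"
    using bij[OF \<open>g \<in> G\<close>] by (simp add: image_set_diff bij_is_inj)
  moreover have "g ` {1..k} = {1..k}"
    using fixed by force
  ultimately show ?thesis
    using permutes_image[OF permutes[OF \<open>g \<in> G\<close>]] by simp
qed

lemma switch_mem_stabilizer:
  assumes "i \<in> {1..n}" "j \<in> {1..n}"
  shows "\<sigma> i j \<in> pointwise_stabilizer G (i - 1)"
proof (cases "\<sigma> i j = id")
  case True
  then show ?thesis by (simp add: id_mem_stabilizer)
next
  case False
  then have "\<sigma> i j \<in> switch_candidates G i j"
    using assms switch_table unfolding switch_table_def by metis
  then show ?thesis
    by (auto simp: pointwise_stabilizer_def switch_candidates_def)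
qed

lemma nontrivial_switch_maps:
  assumes "i \<in> {1..n}" "j \<in> {1..n}" "\<sigma> i j \<noteq> id"
  shows "\<sigma> i j j = i"
proof -
  have "\<sigma> i j \<in> switch_candidates G i j"
    using assms switch_table unfolding switch_table_def by metis
  then show ?thesis
    by (simp add: switch_candidates_def)
qed

text \<open>A point of \<open>{1..n}\<close> below \<open>i\<close> is fixed by \<open>g\<close> and
  hence cannot be sent to \<open>i\<close>. So a preimage other than \<open>i\<close> is a column in
  which row \<open>i\<close> may hold a switch.\<close>

lemma stabilizer_preimage_range:
  assumes g: "g \<in> pointwise_stabilizer G (i - 1)" and i: "i \<in> {1..n}" and "g j = i"
  shows "i \<le> j" "j \<le> n"
proof -
  have "g \<in> G" and fixed: "\<forall>l\<in>{1..i - 1}. g l = l"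
    using g by (auto simp: pointwise_stabilizer_def)
  have "j \<in> {1..n}"
    using permutes_in_image[OF permutes[OF \<open>g \<in> G\<close>]] i \<open>g j = i\<close> by metis
  moreover from this have "\<not> j < i"
    using fixed[rule_format, of j] \<open>g j = i\<close> by fastforce
  ultimately show "i \<le> j" "j \<le> n"
    by auto
qed

lemma stabilizer_fix_iff:
  assumes "i \<in> {1..n}"
  shows "g \<in> pointwise_stabilizer G i \<longleftrightarrow> g \<in> pointwise_stabilizer G (i - 1) \<and> g i = i"
proof -
  have "{1..i} = insert i {1..i - 1}"
    using assms by auto
  then show ?thesis
    by (auto simp: pointwise_stabilizer_def)
qed

text \<open>Both \<open>g\<close> and \<open>\<sigma> i j\<close> send \<open>j\<close> to
  \<open>i\<close> and fix everything below \<open>i\<close>. Hence \<open>g\<close> after the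
  inverse of the switch fixes all of \<open>{1..i}\<close>, which supplies the factor
  \<open>g'\<close>.\<close>

lemma switch_factorization:
  assumes g: "g \<in> pointwise_stabilizer G (i - 1)" and i: "i \<in> {1..n}"
    and "g j = i" and "j \<noteq> i"
  obtains g' where "g' \<in> pointwise_stabilizer G i" "g = g' \<circ> \<sigma> i j" "\<sigma> i j \<noteq> id" "j \<in> {1..n}"
proof -
  from stabilizer_preimage_range[OF g i \<open>g j = i\<close>] \<open>j \<noteq> i\<close> i
  have j: "i < j" "j \<in> {1..n}" by auto
  have "{1..<i} \<subseteq> {1..i - 1}"
    by auto
  then have "g \<in> switch_candidates G i j"
    using g \<open>g j = i\<close> unfolding pointwise_stabilizer_def switch_candidates_def by blast
  \<comment> \<open>The permutation \<open>g\<close> witnesses that candidates exist, so the table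
    entry is one of them and not the default \<open>id\<close>.\<close>
  then have s: "\<sigma> i j \<in> switch_candidates G i j"
    using switch_table i j unfolding switch_table_def by (metis empty_iff)
  then have "\<sigma> i j \<in> G" and sj: "\<sigma> i j j = i" and fixed: "\<And>k. k \<in> {1..<i} \<Longrightarrow> \<sigma> i j k = k"
    by (auto simp: switch_candidates_def)
  note b = bij[OF \<open>\<sigma> i j \<in> G\<close>]
  let ?g' = "g \<circ> inv' (\<sigma> i j)"
  have "?g' k = k" if "k \<in> {1..i}" for k
  proof (cases "k = i")
    case True
    then have "inv' (\<sigma> i j) k = j"
      using inv_f_eq[OF bij_is_inj[OF b] sj] by simp
    then show ?thesis using True \<open>g j = i\<close> by simp
  next
    case False
    then have k: "k \<in> {1..<i}" using that by auto
    then have "inv' (\<sigma> i j) k = k"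
      by (rule inv_f_eq[OF bij_is_inj[OF b] fixed])
    then show ?thesis using k g by (auto simp: pointwise_stabilizer_def)
  qed
  then have "?g' \<in> pointwise_stabilizer G i"
    using comp_mem[OF _ inv_mem[OF \<open>\<sigma> i j \<in> G\<close>]] g by (auto simp: pointwise_stabilizer_def)
  moreover have "g = ?g' \<circ> \<sigma> i j"
    using b by (simp add: comp_assoc bij_is_inj)
  moreover have "\<sigma> i j \<noteq> id"
    using sj \<open>j \<noteq> i\<close> by auto
  ultimately show ?thesis using that j by blast
qed

text \<open>Points below \<open>i\<close> are fixed by assumption and points outside
  \<open>{1..n}\<close> by the support of \<open>g\<close>. For the others, strong induction
  applies: moving a point onto \<open>k\<close> while fixing everything below \<open>k\<close> would
  force a non-trivial switch in row \<open>k\<close>, which is not effective.\<close>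

lemma stabilizer_trivial_above_effective_rows:
  assumes g: "g \<in> pointwise_stabilizer G (i - 1)" and "1 \<le> i"
    and above: "Fin i > Max_ext (effective_rows n \<sigma>)"
  shows "g = id"
proof -
  have "g k = k" for k
  proof (induction k rule: less_induct)
    case (less k)
    show ?case
    proof (cases "k \<in> {i..n}")
      case True
      then have k: "k \<in> {1..n}" using \<open>1 \<le> i\<close> by auto
      \<comment> \<open>The induction hypothesis fixes every point below \<open>k\<close>, so the
        factorization can be applied in row \<open>k\<close> instead of row
        \<open>i\<close>.\<close>
      have gk: "g \<in> pointwise_stabilizer G (k - 1)"
        using less g k by (auto simp: pointwise_stabilizer_def)
      have "bij g" using g bij pointwise_stabilizer_subset by blast
      then obtain j where j: "g j = k" by (metis bij_pointE)
      have "k \<notin> effective_rows n \<sigma>"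
      proof
        assume "k \<in> effective_rows n \<sigma>"
        then have "Fin k < Fin i"
          using effective_row_le_Max_ext above le_less_trans by blast
        then show False using True by simp
      qed
      then have "j = k"
        using switch_factorization[OF gk k j] k by (auto simp: effective_rows_def)
      then show ?thesis using j by simp
    next
      case False
      show ?thesis
      proof (cases "k \<in> {1..n}")
        case True
        then have "k \<in> {1..i - 1}" using False by auto
        then show ?thesis using g by (auto simp: pointwise_stabilizer_def)
      next
        case False
        have "g \<in> G" using g pointwise_stabilizer_subset by blast
        then show ?thesis using permutes_not_in[OF permutes False] by blast
      qed
    qed
  qed
  then show ?thesis by (simp add: fun_eq_iff)
qed

section \<open>Comparing images of \<open>S'\<close> with \<open>S\<close> at a fixed row
  \<open>i\<close>\<close>

context
  fixes i :: nat and S S' :: "nat set"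
  assumes i: "i \<in> {1..n}"
    and S: "S \<subseteq> {1..n} - {1..i - 1}" and S': "S' \<subseteq> {1..n} - {1..i - 1}"
    and card_eq: "card S = card S'"
begin

lemma finite_sets: "finite S" "finite S'"
  using S S' finite_subset by blast+

lemma bound_le: "i - 1 \<le> n"
  using i by auto

lemma subset_atLeast: "S \<subseteq> {i..}"
  using S by auto

lemma image_subset_atLeast:
  assumes "g \<in> pointwise_stabilizer G (i - 1)"
  shows "g ` S' \<subseteq> {i..}"
proof -
  have "g ` S' \<subseteq> g ` ({1..n} - {1..i - 1})"
    using S' by blast
  also have "\<dots> = {1..n} - {1..i - 1}"
    using stabilizer_image_tail[OF assms bound_le] .
  finally show ?thesis by auto
qed

lemma no_smaller_image_if_empty_or_full:
  assumes "S = {} \<or> S = {1..n} - {1..i - 1}"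
  shows "\<not> (\<exists>g\<in>pointwise_stabilizer G (i - 1). g ` S' \<prec>\<^sub>l\<^sub>e\<^sub>x S)"
proof (cases "S = {}")
  case True
  then show ?thesis by (simp add: not_set_prec_empty)
next
  case False
  then have full: "S = {1..n} - {1..i - 1}" using assms by blast
  \<comment> \<open>\<open>S'\<close> is a subset of the finite set \<open>S\<close> of the same
    cardinality.\<close>
  then have "S' = S"
    using S' card_eq by (simp add: card_subset_eq)
  moreover have "g ` S = S" if "g \<in> pointwise_stabilizer G (i - 1)" for g
    unfolding full by (rule stabilizer_image_tail[OF that bound_le])
  ultimately show ?thesis by (auto simp: set_prec_irrefl)
qed

text \<open>Either alternative reduces the stabilizer to \<open>{id}\<close>, leaving
  \<open>S'\<close> itself as the only image.\<close>

lemma smaller_image_if_trivial: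
  assumes "G = {id} \<or> Fin i > Max_ext (effective_rows n \<sigma>)"
  shows "(\<exists>g\<in>pointwise_stabilizer G (i - 1). g ` S' \<prec>\<^sub>l\<^sub>e\<^sub>x S) \<longleftrightarrow> S' \<prec>\<^sub>l\<^sub>e\<^sub>x S"
proof -
  have "g = id" if "g \<in> pointwise_stabilizer G (i - 1)" for g
    using assms that stabilizer_trivial_above_effective_rows[OF that] i
      pointwise_stabilizer_subset by auto
  then have "pointwise_stabilizer G (i - 1) = {id}"
    using id_mem_stabilizer by blast
  then show ?thesis by simp
qed

text \<open>Since \<open>g\<close> sends \<open>j\<close> to \<open>i\<close>, the point
  \<open>i\<close> is the minimum of both sets. Injectivity ensures that deleting \<open>j\<close>
  before applying \<open>g\<close> amounts to deleting \<open>i\<close> afterwards.\<close>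

lemma set_prec_image_iff_remove:
  assumes "i \<in> S" "g \<in> pointwise_stabilizer G (i - 1)" "j \<in> S'" "g j = i"
  shows "g ` S' \<prec>\<^sub>l\<^sub>e\<^sub>x S \<longleftrightarrow> g ` (S' - {j}) \<prec>\<^sub>l\<^sub>e\<^sub>x S - {i}"
proof -
  have "inj g"
    using assms(2) pointwise_stabilizer_subset bij bij_is_inj by blast
  then have "g ` (S' - {j}) = g ` S' - {i}"
    using \<open>g j = i\<close> by (simp add: image_set_diff)
  moreover have "i \<in> g ` S'"
    using assms by blast
  ultimately show ?thesis
    using set_prec_remove_common_min[of "g ` S'" S i] assms finite_sets subset_atLeast
      image_subset_atLeast by simp
qed

text \<open>A nonempty image missing \<open>i\<close> cannot precede \<open>S\<close>, so the
  preimage \<open>j\<close> of \<open>i\<close> must lie in \<open>S'\<close>. The two alternatives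
  are \<open>j = i\<close> and \<open>j \<noteq> i\<close>; in both, \<open>i\<close> is stripped
  from the comparison.\<close>

lemma smaller_image_if_mem:
  assumes "i \<in> S"
  shows "(\<exists>g\<in>pointwise_stabilizer G (i - 1). g ` S' \<prec>\<^sub>l\<^sub>e\<^sub>x S) \<longleftrightarrow>
           (i \<in> S' \<and> (\<exists>g'\<in>pointwise_stabilizer G i. g' ` (S' - {i}) \<prec>\<^sub>l\<^sub>e\<^sub>x S - {i})) \<or>
           (\<exists>j\<in>{1..n}. \<sigma> i j \<noteq> id \<and> j \<in> S' \<and>
              (\<exists>g'\<in>pointwise_stabilizer G i. g' ` (\<sigma> i j ` (S' - {j})) \<prec>\<^sub>l\<^sub>e\<^sub>x S - {i}))"
    (is "?L \<longleftrightarrow> ?A \<or> ?B")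
proof
  assume ?L
  then obtain g where g: "g \<in> pointwise_stabilizer G (i - 1)" and less: "g ` S' \<prec>\<^sub>l\<^sub>e\<^sub>x S"
    by blast
  \<comment> \<open>Equal cardinality excludes the empty image, which would precede \<open>S\<close>
    without containing \<open>i\<close>.\<close>
  have "S' \<noteq> {}"
    using assms card_eq finite_sets by auto
  then have "i \<in> g ` S'"
    using not_set_prec_if_min_right[of "g ` S'" S i] less assms finite_sets subset_atLeast
      image_subset_atLeast[OF g] by auto
  then obtain j where j: "j \<in> S'" "g j = i" by blast
  have less': "g ` (S' - {j}) \<prec>\<^sub>l\<^sub>e\<^sub>x S - {i}"
    using set_prec_image_iff_remove[OF assms g j] less by blast
  show "?A \<or> ?B"
  proof (cases "j = i")
    case True
    then show ?thesis
      using less' j g stabilizer_fix_iff[OF i] by blast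
  next
    case False
    obtain g' where "g' \<in> pointwise_stabilizer G i" "g = g' \<circ> \<sigma> i j" "\<sigma> i j \<noteq> id" "j \<in> {1..n}"
      by (rule switch_factorization[OF g i j(2) False])
    then show ?thesis
      using less' j by (auto simp: image_comp)
  qed
next
  assume "?A \<or> ?B"
  then show ?L
  proof
    assume ?A
    then obtain g' where "i \<in> S'" "g' \<in> pointwise_stabilizer G i" "g' ` (S' - {i}) \<prec>\<^sub>l\<^sub>e\<^sub>x S - {i}"
      by blast
    then show ?L
      using set_prec_image_iff_remove[OF assms] stabilizer_fix_iff[OF i] by blast
  next
    assume ?B
    then obtain j g' where j: "j \<in> {1..n}" "\<sigma> i j \<noteq> id" "j \<in> S'"
      and g': "g' \<in> pointwise_stabilizer G i"
      and less: "(g' \<circ> \<sigma> i j) ` (S' - {j}) \<prec>\<^sub>l\<^sub>e\<^sub>x S - {i}"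
      by (auto simp: image_comp)
    have g: "g' \<circ> \<sigma> i j \<in> pointwise_stabilizer G (i - 1)" and "g' i = i"
      using comp_mem_stabilizer switch_mem_stabilizer[OF i j(1)] g' stabilizer_fix_iff[OF i]
      by blast+
    then have "(g' \<circ> \<sigma> i j) j = i"
      using nontrivial_switch_maps[OF i j(1,2)] by simp
    then show ?L
      using set_prec_image_iff_remove[OF assms g j(3)] less g by blast
  qed
qed

text \<open>An image containing \<open>i\<close> precedes \<open>S\<close> at once, which settles
  \<open>?A\<close> and \<open>?B\<close>. Conversely, the preimage \<open>j\<close> of
  \<open>i\<close> decides: \<open>j = i\<close> gives \<open>?C\<close>, and otherwise
  \<open>?B\<close> or \<open>?D\<close> holds according to whether \<open>j\<close> lies in
  \<open>S'\<close>.\<close>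

lemma smaller_image_if_notmem:
  assumes "i \<notin> S"
  shows "(\<exists>g\<in>pointwise_stabilizer G (i - 1). g ` S' \<prec>\<^sub>l\<^sub>e\<^sub>x S) \<longleftrightarrow>
           i \<in> S' \<or>
           effective_columns n \<sigma> i \<inter> S' \<noteq> {} \<or>
           (\<exists>g'\<in>pointwise_stabilizer G i. g' ` S' \<prec>\<^sub>l\<^sub>e\<^sub>x S) \<or>
           (\<exists>j\<in>{1..n}. j \<notin> S' \<and>
              (\<exists>g'\<in>pointwise_stabilizer G i. g' ` (\<sigma> i j ` S') \<prec>\<^sub>l\<^sub>e\<^sub>x S))"
    (is "?L \<longleftrightarrow> ?A \<or> ?B \<or> ?C \<or> ?D")
proof
  assume ?L
  then obtain g where g: "g \<in> pointwise_stabilizer G (i - 1)" and less: "g ` S' \<prec>\<^sub>l\<^sub>e\<^sub>x S"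
    by blast
  have "bij g"
    using g bij pointwise_stabilizer_subset by blast
  then obtain j where j: "g j = i" by (metis bij_pointE)
  show "?A \<or> ?B \<or> ?C \<or> ?D"
  proof (cases "j = i")
    case True
    then show ?thesis
      using less j g stabilizer_fix_iff[OF i] by blast
  next
    case False
    obtain g' where "g' \<in> pointwise_stabilizer G i" "g = g' \<circ> \<sigma> i j" "\<sigma> i j \<noteq> id" "j \<in> {1..n}"
      by (rule switch_factorization[OF g i j False])
    then show ?thesis
      using less by (cases "j \<in> S'") (auto simp: image_comp effective_columns_def)
  qed
next
  have sufficient: ?L if "g \<in> pointwise_stabilizer G (i - 1)" "i \<in> g ` S'" for g
  proof -
    \<comment> \<open>\<open>S'\<close> has an element mapped to \<open>i\<close>, and equal
      cardinality carries nonemptiness over to \<open>S\<close>.\<close>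
    have "S \<noteq> {}"
      using that card_eq finite_sets by auto
    then have "g ` S' \<prec>\<^sub>l\<^sub>e\<^sub>x S"
      using that assms finite_sets subset_atLeast image_subset_atLeast
      by (intro set_prec_if_min_left[of _ _ i]) auto
    then show ?L using that by blast
  qed
  assume "?A \<or> ?B \<or> ?C \<or> ?D"
  then consider ?A | ?B | ?C | ?D by blast
  then show ?L
  proof cases
    assume ?A
    then show ?L by (intro sufficient[OF id_mem_stabilizer]) simp
  next
    assume ?B
    then obtain j where j: "j \<in> {1..n}" "\<sigma> i j \<noteq> id" "j \<in> S'"
      by (auto simp: effective_columns_def)
    then have "i \<in> \<sigma> i j ` S'"
      using nontrivial_switch_maps[OF i j(1,2)] by force
    then show ?L by (rule sufficient[OF switch_mem_stabilizer[OF i j(1)]])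
  next
    assume ?C
    then show ?L using stabilizer_fix_iff[OF i] by blast
  next
    assume ?D
    then obtain j g' where j: "j \<in> {1..n}" and g': "g' \<in> pointwise_stabilizer G i"
      and less: "(g' \<circ> \<sigma> i j) ` S' \<prec>\<^sub>l\<^sub>e\<^sub>x S"
      by (auto simp: image_comp)
    \<comment> \<open>The switch may be trivial here; it lies in the stabilizer in that case
      too.\<close>
    have "g' \<circ> \<sigma> i j \<in> pointwise_stabilizer G (i - 1)"
      using comp_mem_stabilizer switch_mem_stabilizer[OF i j] g' stabilizer_fix_iff[OF i]
      by blast
    then show ?L using less by blast
  qed
qed

lemmas smaller_image_characterization =
  no_smaller_image_if_empty_or_full smaller_image_if_trivial smaller_image_if_mem smaller_image_if_notmem

end

end

theorem lemma5:
  fixes n i :: nat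
    and G :: "(nat \<Rightarrow> nat) set"
    and \<sigma> :: "nat \<Rightarrow> nat \<Rightarrow> (nat \<Rightarrow> nat)"
    and S S' :: "nat set"
  assumes "subgroup G (sym_group n)"
    and "switch_table n G \<sigma>"
    and "1 \<le> i" and "i \<le> n"
    and "S \<subseteq> {1..n} - {1..i - 1}" and "S' \<subseteq> {1..n} - {1..i - 1}"
    and "card S = card S'"
  shows
    \<comment> \<open>(i)\<close>
    "(S = {} \<or> S = {1..n} - {1..i - 1} \<longrightarrow>
        \<not> (\<exists>g\<in>pointwise_stabilizer G (i - 1). g ` S' \<prec>\<^sub>l\<^sub>e\<^sub>x S)) \<and>
     \<comment> \<open>(ii)\<close>
     (G = {id} \<or> Fin i > Max_ext (effective_rows n \<sigma>) \<longrightarrow>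
        ((\<exists>g\<in>pointwise_stabilizer G (i - 1). g ` S' \<prec>\<^sub>l\<^sub>e\<^sub>x S) \<longleftrightarrow> S' \<prec>\<^sub>l\<^sub>e\<^sub>x S)) \<and>
     \<comment> \<open>(iii)\<close>
     (i \<in> S \<longrightarrow>
        ((\<exists>g\<in>pointwise_stabilizer G (i - 1). g ` S' \<prec>\<^sub>l\<^sub>e\<^sub>x S) \<longleftrightarrow>
           (i \<in> S' \<and> (\<exists>g'\<in>pointwise_stabilizer G i. g' ` (S' - {i}) \<prec>\<^sub>l\<^sub>e\<^sub>x S - {i})) \<or>
           (\<exists>j\<in>{1..n}. \<sigma> i j \<noteq> id \<and> j \<in> S' \<and>
              (\<exists>g'\<in>pointwise_stabilizer G i. g' ` (\<sigma> i j ` (S' - {j})) \<prec>\<^sub>l\<^sub>e\<^sub>x S - {i})))) \<and>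
     \<comment> \<open>(iv)\<close>
     (i \<notin> S \<longrightarrow>
        ((\<exists>g\<in>pointwise_stabilizer G (i - 1). g ` S' \<prec>\<^sub>l\<^sub>e\<^sub>x S) \<longleftrightarrow>
           i \<in> S' \<or>
           effective_columns n \<sigma> i \<inter> S' \<noteq> {} \<or>
           (\<exists>g'\<in>pointwise_stabilizer G i. g' ` S' \<prec>\<^sub>l\<^sub>e\<^sub>x S) \<or>
           (\<exists>j\<in>{1..n}. j \<notin> S' \<and>
              (\<exists>g'\<in>pointwise_stabilizer G i. g' ` (\<sigma> i j ` S') \<prec>\<^sub>l\<^sub>e\<^sub>x S)))) \<and>
     \<comment> \<open>the special case i = 1, S' = S, for every subset of [n]\<close>
     (\<forall>T. T \<subseteq> {1..n} \<longrightarrow>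
        (T = {} \<or> T = {1..n} \<longrightarrow> \<not> (\<exists>g\<in>G. g ` T \<prec>\<^sub>l\<^sub>e\<^sub>x T)) \<and>
        (G = {id} \<or> Fin 1 > Max_ext (effective_rows n \<sigma>) \<longrightarrow>
           ((\<exists>g\<in>G. g ` T \<prec>\<^sub>l\<^sub>e\<^sub>x T) \<longleftrightarrow> T \<prec>\<^sub>l\<^sub>e\<^sub>x T)) \<and>
        (1 \<in> T \<longrightarrow>
           ((\<exists>g\<in>G. g ` T \<prec>\<^sub>l\<^sub>e\<^sub>x T) \<longleftrightarrow>
              (1 \<in> T \<and> (\<exists>g'\<in>pointwise_stabilizer G 1. g' ` (T - {1}) \<prec>\<^sub>l\<^sub>e\<^sub>x T - {1})) \<or>
              (\<exists>j\<in>{1..n}. \<sigma> 1 j \<noteq> id \<and> j \<in> T \<and>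
                 (\<exists>g'\<in>pointwise_stabilizer G 1. g' ` (\<sigma> 1 j ` (T - {j})) \<prec>\<^sub>l\<^sub>e\<^sub>x T - {1})))) \<and>
        (1 \<notin> T \<longrightarrow>
           ((\<exists>g\<in>G. g ` T \<prec>\<^sub>l\<^sub>e\<^sub>x T) \<longleftrightarrow>
              1 \<in> T \<or>
              effective_columns n \<sigma> 1 \<inter> T \<noteq> {} \<or>
              (\<exists>g'\<in>pointwise_stabilizer G 1. g' ` T \<prec>\<^sub>l\<^sub>e\<^sub>x T) \<or>
              (\<exists>j\<in>{1..n}. j \<notin> T \<and>
                 (\<exists>g'\<in>pointwise_stabilizer G 1. g' ` (\<sigma> 1 j ` T) \<prec>\<^sub>l\<^sub>e\<^sub>x T)))))"
proof -
  interpret permutation_group_switch_table n G \<sigma>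
    using assms(1,2) by (rule permutation_group_switch_table.intro)
  \<comment> \<open>The existence of row \<open>i\<close> forces \<open>n\<close> to be at least 1,
    so row 1 is available for the special case.\<close>
  have i: "i \<in> {1..n}" and one: "1 \<in> {1..n}"
    using assms(3,4) by auto
  note general = smaller_image_characterization[OF i assms(5-7)]
  show ?thesis (is "?i \<and> ?ii \<and> ?iii \<and> ?iv \<and> (\<forall>T. T \<subseteq> {1..n} \<longrightarrow> ?special T)")
  proof (intro conjI)
    show ?i ?ii ?iii ?iv
      by (rule impI, rule general, assumption)+
    show "\<forall>T. T \<subseteq> {1..n} \<longrightarrow> ?special T"
    proof (intro allI impI)
      fix T
      assume "T \<subseteq> {1..n}"
      \<comment> \<open>The interval \<open>{1..1 - 1}\<close> is empty, so any \<open>T\<close> in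
        \<open>{1..n}\<close> fits the general hypotheses at row 1. Folding with \<open>full\<close>
        and unfolding \<open>pointwise_stabilizer_0\<close> then recover \<open>{1..n}\<close> and
        \<open>G\<close>.\<close>
      then have T: "T \<subseteq> {1..n} - {1..1 - 1}" and full: "{1..n} = {1..n} - {1..1 - (1::nat)}"
        by simp_all
      note special = smaller_image_characterization[OF one T T refl, folded full,
          unfolded diff_self_eq_0 pointwise_stabilizer_0]
      show "?special T"
        by (intro conjI; rule impI, rule special, assumption)
    qed
  qed
qed

end
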